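(* Let $g\in C^1(\mathbb{R}^n)$ and $u(x,t)=\min_{|x-y|\le t}g(y)$. Then $u$ is $C^1$ on $(\mathbb{R}^n\times\{t>0\})\setminus\Sigma$.
   Context: $|\cdot|$ is the Euclidean norm. $u$ is the Hopf–Lax solution of $u_t+|\nabla u|=0$ with $u(\cdot,0)=g$. $\Sigma\subset\mathbb{R}^n\times\{t>0\}$ is the set of all points where $u$ is not differentiable. The set $(\mathbb{R}^n\times\{t>0\})\setminus\Sigma$ is not necessarily open; "$u$ is $C^1$" on it means that $u$ is differentiable at each of its points and that the full gradient $Du=(\nabla u,u_t)$, restricted to this set, is continuous. *)

theory Defs
  imports "HOL-Analysis.Analysis"
begin

text \<open>
  Space-time is the product \<^typ>\<open>(real ^ 'n) \<times> real\<close>, whose inner product is the sum of the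
  two inner products; so \<open>GDERIV u (x, t) :> D\<close> says that \<open>u\<close> is Frechet differentiable at
  \<open>(x, t)\<close> jointly in both variables, with full gradient \<open>D = (\<nabla>u, u\<^sub>t)\<close>.

  The set \<open>S\<close> below need not be open: differentiability is required in the ambient space
  (\<open>GDERIV\<close> uses the filter \<open>at p\<close>, not \<open>at p within S\<close>), and only the continuity of the
  gradient is relative to \<open>S\<close>.
\<close>

definition C1_on :: "'a::real_inner set \<Rightarrow> ('a \<Rightarrow> real) \<Rightarrow> bool" where
  "C1_on S f \<longleftrightarrow> (\<exists>D. (\<forall>p\<in>S. GDERIV f p :> D p) \<and> continuous_on S D)"

text \<open>The value is unspecified for \<open>t < 0\<close>, where the ball is empty.\<close>

definition hopf_lax :: "(real ^ 'n \<Rightarrow> real) \<Rightarrow> (real ^ 'n) \<times> real \<Rightarrow> real" where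
  "hopf_lax g = (\<lambda>(x, t). LEAST v. v \<in> g ` {y. norm (x - y) \<le> t})"

definition upper_half :: "((real ^ 'n) \<times> real) set" where
  "upper_half = {(x, t). t > 0}"

definition singular_set :: "((real ^ 'n) \<times> real \<Rightarrow> real) \<Rightarrow> ((real ^ 'n) \<times> real) set" where
  "singular_set u = {p \<in> upper_half. \<not> u differentiable (at p)}"

text \<open>The minimum is attained, so \<open>LEAST\<close> above is well defined.\<close>

lemma hopf_lax_is_min:
  fixes g :: "real ^ 'n \<Rightarrow> real"
  assumes "continuous_on UNIV g" and "t \<ge> 0"
  shows "\<exists>y. norm (x - y) \<le> t \<and> hopf_lax g (x, t) = g y \<and>
             (\<forall>z. norm (x - z) \<le> t \<longrightarrow> g y \<le> g z)"
proof -
  have "compact (cball x t)" "cball x t \<noteq> {}" "continuous_on (cball x t) g"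
    using assms continuous_on_subset by auto
  from continuous_attains_inf[OF this]
  obtain y where y: "norm (x - y) \<le> t" "\<And>z. norm (x - z) \<le> t \<Longrightarrow> g y \<le> g z"
    by (auto simp: dist_norm)
  have "hopf_lax g (x, t) = g y"
    unfolding hopf_lax_def prod.case by (rule Least_equality) (use y in auto)
  with y show ?thesis by blast
qed

end

theory Submission
  imports Defs
begin

text \<open>
  Let \<open>y\<close> be a minimiser of \<open>g\<close> over the ball of radius \<open>t\<close> about \<open>x\<close>. Translating and dilating
  that ball to radius \<open>t'\<close> and centre \<open>x'\<close> carries \<open>y\<close> to the admissible point
  \<open>x' + (t'/t) (y - x)\<close>, so \<open>u(x', t') \<le> g(x' + (t'/t) (y - x))\<close>, with equality at \<open>(x, t)\<close>.
  The right-hand side is a differentiable function of \<open>(x', t')\<close>. Wherever \<open>u\<close> is differentiable,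
  two functions that touch in this way have the same gradient, and so
  \<open>Du(x, t) = (\<nabla>g(y), \<nabla>g(y) \<bullet> (y - x) / t)\<close> for \<^emph>\<open>every\<close> minimiser \<open>y\<close>
  (\<open>hopf_lax_gradient_at_minimizer\<close>).

  The freedom in the choice of \<open>y\<close> yields continuity of the gradient. The formula is continuous in
  \<open>(x, t, y)\<close>, minimisers belonging to a convergent sequence of points stay bounded, and their
  cluster points are again minimisers (\<open>minimizer_limit\<close>). So along a suitable subsequence the
  gradients converge to the formula evaluated at \<^emph>\<open>some\<close> minimiser of the limit point, and
  that value is the gradient there.
\<close>

definition minimizer :: "(real ^ 'n \<Rightarrow> real) \<Rightarrow> (real ^ 'n) \<times> real \<Rightarrow> real ^ 'n \<Rightarrow> bool" where
  "minimizer g p y \<longleftrightarrow> norm (fst p - y) \<le> snd p \<and> hopf_lax g p = g y"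

lemma GDERIV_unique:
  assumes "GDERIV f x :> D" and "GDERIV f x :> D'"
  shows "D = D'"
proof -
  have "(\<lambda>h. h \<bullet> D) = (\<lambda>h. h \<bullet> D')"
    using assms unfolding gderiv_def by (rule has_derivative_unique)
  then show ?thesis
    by (metis vector_eq_ldot)
qed

lemma hopf_lax_le:
  fixes g :: "real ^ 'n \<Rightarrow> real"
  assumes "continuous_on UNIV g" and "norm (fst p - z) \<le> snd p"
  shows "hopf_lax g p \<le> g z"
proof -
  have "snd p \<ge> 0"
    using assms(2) norm_ge_zero order_trans by blast
  from hopf_lax_is_min[OF assms(1) this, of "fst p"] assms(2) show ?thesis
    by auto
qed

lemma minimizer_exists:
  fixes g :: "real ^ 'n \<Rightarrow> real"
  assumes "continuous_on UNIV g" and "snd p \<ge> 0"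
  shows "\<exists>y. minimizer g p y"
  using hopf_lax_is_min[OF assms, of "fst p"] by (auto simp: minimizer_def)

text \<open>The test function \<open>g (x' + (t'/t) (y - x))\<close> moves the minimiser along with the ball; the
  dilation keeps it admissible for smaller radii too, so the test function lies above \<open>u\<close> on both
  sides of \<open>t\<close> and fixes the time derivative as well.\<close>

lemma hopf_lax_gradient_at_minimizer:
  fixes g :: "real ^ 'n \<Rightarrow> real"
  assumes cont: "continuous_on UNIV g"
    and p: "p \<in> upper_half - singular_set (hopf_lax g)"
    and y: "minimizer g p y"
    and G: "GDERIV g y :> G"
  shows "GDERIV (hopf_lax g) p :> (G, G \<bullet> (y - fst p) / snd p)"
proof -
  obtain x t where xt: "p = (x, t)"
    by (cases p)
  have t: "t > 0" and diff: "hopf_lax g differentiable (at p)"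
    using p by (auto simp: upper_half_def singular_set_def xt)
  obtain u' where u': "(hopf_lax g has_derivative u') (at p)"
    using diff by (auto simp: differentiable_def)
  define move where "move q = fst q + (snd q / t) *\<^sub>R (y - x)" for q :: "(real ^ 'n) \<times> real"
  have move_p: "move p = y"
    using t by (simp add: move_def xt)
  have "(move has_derivative (\<lambda>h. fst h + (snd h / t) *\<^sub>R (y - x))) (at p)"
    unfolding move_def using t by (auto intro!: derivative_eq_intros)
  moreover have "(g has_derivative (\<lambda>h. h \<bullet> G)) (at (move p))"
    using G by (simp add: gderiv_def move_p)
  ultimately have test':
    "((\<lambda>q. g (move q)) has_derivative (\<lambda>h. (fst h + (snd h / t) *\<^sub>R (y - x)) \<bullet> G)) (at p)"
    by (rule has_derivative_compose)
  have le: "hopf_lax g q - g (move q) \<le> hopf_lax g p - g (move p)" if "0 < snd q" for q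
  proof -
    have "norm (fst q - move q) = snd q / t * norm (x - y)"
      using t that by (simp add: move_def norm_minus_commute)
    also have "\<dots> \<le> snd q / t * t"
      using y t that by (intro mult_left_mono) (auto simp: minimizer_def xt)
    finally have "hopf_lax g q \<le> g (move q)"
      using t by (intro hopf_lax_le[OF cont]) simp
    then show ?thesis
      using y by (simp add: move_p minimizer_def)
  qed
  have "(\<lambda>h. u' h - (fst h + (snd h / t) *\<^sub>R (y - x)) \<bullet> G) = (\<lambda>h. 0)"
  proof (rule differential_zero_maxmin)
    show "p \<in> {q. 0 < snd q}" "open {q :: (real ^ 'n) \<times> real. 0 < snd q}"
      using t by (auto simp: xt intro!: open_Collect_less continuous_on_snd)
    show "((\<lambda>q. hopf_lax g q - g (move q)) has_derivative
        (\<lambda>h. u' h - (fst h + (snd h / t) *\<^sub>R (y - x)) \<bullet> G)) (at p)"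
      using u' test' by (rule has_derivative_diff)
  qed (use le in auto)
  then have "u' h = (fst h + (snd h / t) *\<^sub>R (y - x)) \<bullet> G" for h
    by (meson eq_iff_diff_eq_0 fun_cong)
  then have "u' h = h \<bullet> (G, G \<bullet> (y - fst p) / snd p)" for h
    by (simp add: xt inner_prod_def inner_add_left inner_commute[of G])
  then have "u' = (\<lambda>h. h \<bullet> (G, G \<bullet> (y - fst p) / snd p))" ..
  with u' show ?thesis
    by (simp add: gderiv_def)
qed

lemma minimizer_limit:
  fixes g :: "real ^ 'n \<Rightarrow> real"
  assumes "continuous_on UNIV g" and "isCont (hopf_lax g) p"
    and X: "X \<longlonglongrightarrow> p" and Y: "Y \<longlonglongrightarrow> y"
    and XY: "\<And>n. minimizer g (X n) (Y n)"
  shows "minimizer g p y"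
proof -
  have "(\<lambda>n. norm (fst (X n) - Y n)) \<longlonglongrightarrow> norm (fst p - y)" "(\<lambda>n. snd (X n)) \<longlonglongrightarrow> snd p"
    by (intro tendsto_intros X Y)+
  then have "norm (fst p - y) \<le> snd p"
    by (rule LIMSEQ_le) (use XY in \<open>auto simp: minimizer_def\<close>)
  moreover have "(\<lambda>n. g (Y n)) \<longlonglongrightarrow> hopf_lax g p"
    using isCont_tendsto_compose[OF assms(2) X] XY by (simp add: minimizer_def)
  moreover have "(\<lambda>n. g (Y n)) \<longlonglongrightarrow> g y"
    using assms(1) Y by (auto intro: isCont_tendsto_compose simp: continuous_on_eq_continuous_at)
  ultimately show ?thesis
    using LIMSEQ_unique by (auto simp: minimizer_def)
qed

lemma minimizers_bounded:
  assumes "Bseq X" and "\<And>n. minimizer g (X n) (Y n)"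
  shows "bounded (range Y)"
proof -
  obtain K where K: "\<And>n. norm (X n) \<le> K"
    using assms(1) by (auto simp: Bseq_def)
  have "norm (Y n) \<le> K + K" for n
  proof -
    have "norm (Y n) \<le> norm (fst (X n)) + norm (fst (X n) - Y n)"
      by (metis norm_minus_commute norm_triangle_sub)
    also have "\<dots> \<le> norm (X n) + norm (X n)"
      using assms(2)[of n] norm_fst_le[of "fst (X n)" "snd (X n)"]
        norm_snd_le[of "snd (X n)" "fst (X n)"]
      by (auto simp: minimizer_def)
    finally show ?thesis
      using K[of n] by linarith
  qed
  then show ?thesis
    by (auto simp: bounded_iff)
qed

theorem proposition3p40:
  fixes g :: "real ^ 'n \<Rightarrow> real"
  assumes "C1_on UNIV g"
  shows "C1_on (upper_half - singular_set (hopf_lax g)) (hopf_lax g)"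
proof -
  let ?S = "upper_half - singular_set (hopf_lax g)"
  obtain G where G: "\<And>y. GDERIV g y :> G y" and contG: "continuous_on UNIV G"
    using assms by (auto simp: C1_on_def)
  have contg: "continuous_on UNIV g"
    using G has_derivative_continuous unfolding gderiv_def
    by (intro continuous_at_imp_continuous_on ballI) blast
  define F where "F p y = (G y, G y \<bullet> (y - fst p) / snd p)" for p y
  define y where "y p = (SOME y. minimizer g p y)" for p
  have pos: "snd p > 0" if "p \<in> ?S" for p
    using that by (auto simp: upper_half_def)
  have y: "minimizer g p (y p)" if "p \<in> ?S" for p
    unfolding y_def
    by (rule someI_ex[OF minimizer_exists[OF contg less_imp_le[OF pos[OF that]]]])
  have grad: "GDERIV (hopf_lax g) p :> F p z" if "p \<in> ?S" "minimizer g p z" for p z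
    unfolding F_def by (rule hopf_lax_gradient_at_minimizer[OF contg that G])
  have "continuous_on ?S (\<lambda>p. F p (y p))"
    unfolding continuous_on_iff
  proof (rule ccontr)
    assume "\<not> (\<forall>p\<in>?S. \<forall>e>0. \<exists>d>0. \<forall>q\<in>?S. dist q p < d \<longrightarrow> dist (F q (y q)) (F p (y p)) < e)"
    then obtain p e where p: "p \<in> ?S" and e: "e > 0"
      and far: "\<And>d. d > 0 \<Longrightarrow> \<exists>q\<in>?S. dist q p < d \<and> \<not> dist (F q (y q)) (F p (y p)) < e"
      by meson
    have "\<exists>q. q \<in> ?S \<and> dist q p < 1 / Suc n \<and> \<not> dist (F q (y q)) (F p (y p)) < e" for n
      using far[of "1 / Suc n"] by auto
    then obtain X where X: "\<And>n. X n \<in> ?S" "\<And>n. dist (X n) p < 1 / Suc n"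
      "\<And>n. \<not> dist (F (X n) (y (X n))) (F p (y p)) < e"
      by metis
    have Xp: "X \<longlonglongrightarrow> p"
    proof (rule tendsto_dist_iff[THEN iffD2], rule tendsto_sandwich[where f = "\<lambda>_. 0"])
      show "(\<lambda>n. 1 / real (Suc n)) \<longlonglongrightarrow> 0"
        using LIMSEQ_inverse_real_of_nat by (simp add: inverse_eq_divide)
      show "\<forall>\<^sub>F n in sequentially. dist (X n) p \<le> 1 / real (Suc n)"
        using X(2) by (simp add: less_imp_le)
    qed auto
    have "bounded (range (\<lambda>n. y (X n)))"
      by (rule minimizers_bounded[OF convergent_imp_Bseq[OF convergentI[OF Xp]] y[OF X(1)]])
    from bounded_imp_convergent_subsequence[OF this]
    obtain z r where r: "strict_mono (r :: nat \<Rightarrow> nat)" and Yz: "(\<lambda>n. y (X (r n))) \<longlonglongrightarrow> z"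
      by (auto simp: o_def)
    have Xr: "(\<lambda>n. X (r n)) \<longlonglongrightarrow> p"
      using LIMSEQ_subseq_LIMSEQ[OF Xp r] by (simp add: o_def)
    have "isCont (hopf_lax g) p"
      using grad[OF p y[OF p]] has_derivative_continuous unfolding gderiv_def by blast
    then have "minimizer g p z"
      by (rule minimizer_limit[OF contg _ Xr Yz y[OF X(1)]])
    \<comment> \<open>The limiting minimiser \<open>z\<close> may differ from the selected one, but both give the
      gradient of \<open>u\<close> at \<open>p\<close>.\<close>
    then have Fz: "F p z = F p (y p)"
      by (rule GDERIV_unique[OF grad[OF p] grad[OF p y[OF p]]])
    have "(\<lambda>n. G (y (X (r n)))) \<longlonglongrightarrow> G z"
      using contG Yz by (auto intro: isCont_tendsto_compose simp: continuous_on_eq_continuous_at)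
    then have "(\<lambda>n. F (X (r n)) (y (X (r n)))) \<longlonglongrightarrow> F p z"
      unfolding F_def using pos[OF p] by (intro tendsto_intros Yz Xr) auto
    from metric_LIMSEQ_D[OF this e] show False
      using X(3) Fz by auto
  qed
  then show ?thesis
    unfolding C1_on_def
    by (intro exI[of _ "\<lambda>p. F p (y p)"] conjI ballI) (assumption | rule grad y)+
qed

end
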